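(* Let $A=\{a_1,a_2\}$ and $E=\{e_1,e_2\}$ be two alphabets. Then, as formal power series in $z$, $$\sum_{n=0}^{\infty} S_n(A)\,S_{2n-1}(E)\,z^n=\frac{(a_1+a_2)(e_1+e_2)z-a_1a_2(e_1+e_2)\left((e_1+e_2)^2-2e_1e_2\right)z^2}{\left(\sum_{n=0}^{\infty}S_n(-A)e_1^{2n}z^n\right)\left(\sum_{n=0}^{\infty}S_n(-A)e_2^{2n}z^n\right)}.$$
   Context: Here $a_1,a_2,e_1,e_2$ are commuting variables (an alphabet is a set of variables), and identities are between formal power series in $z$ with coefficients in $\mathbb{Z}[a_1,a_2,e_1,e_2]$; the denominator has constant term $1$, so it is invertible. For an alphabet $X=\{x_1,x_2\}$, $S_n(X)$ is defined by $\sum_{n\ge 0}S_n(X)z^n=\frac{1}{(1-x_1z)(1-x_2z)}$, equivalently $S_n(X)=\frac{x_1^{n+1}-x_2^{n+1}}{x_1-x_2}$ for $n\ge 0$, and $S_n(X)=0$ for $n<0$. The quantities $S_n(-A)$ are defined by $\sum_{n\ge 0}S_n(-A)z^n=(1-a_1z)(1-a_2z)$. *)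

theory Defs
  imports
    "HOL-Computational_Algebra.Formal_Power_Series"
    "HOL-Library.Poly_Mapping"
begin

datatype letter = A1 | A2 | E1 | E2

text \<open>
  The polynomial ring \<open>\<int>[a\<^sub>1,a\<^sub>2,e\<^sub>1,e\<^sub>2]\<close>: a monomial is an exponent vector
  \<open>letter \<Rightarrow>\<^sub>0 nat\<close>, and a polynomial is a finitely supported integer-valued function on
  monomials, with the convolution product.
\<close>

type_synonym coeff_ring = "(letter \<Rightarrow>\<^sub>0 nat) \<Rightarrow>\<^sub>0 int"

definition var :: "letter \<Rightarrow> coeff_ring" where
  "var x = Poly_Mapping.single (Poly_Mapping.single x 1) 1"

abbreviation a1 :: coeff_ring where "a1 \<equiv> var A1"
abbreviation a2 :: coeff_ring where "a2 \<equiv> var A2"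
abbreviation e1 :: coeff_ring where "e1 \<equiv> var E1"
abbreviation e2 :: coeff_ring where "e2 \<equiv> var E2"

definition linear_prod :: "'a::comm_ring_1 \<Rightarrow> 'a \<Rightarrow> 'a fps" where
  "linear_prod x1 x2 = (1 - fps_const x1 * fps_X) * (1 - fps_const x2 * fps_X)"

text \<open>
  Division of formal power series in the library needs an \<open>inverse\<close> operation on the coefficients,
  which a polynomial ring does not have. For \<open>g\<close> with constant term \<open>1\<close>,
  \<open>fps_right_inverse g 1\<close> is the inverse of \<open>g\<close> over any commutative ring, by
  lemma \<open>fps_right_inverse\<close>.
\<close>

definition fps_quot :: "'a::comm_ring_1 fps \<Rightarrow> 'a fps \<Rightarrow> 'a fps" where
  "fps_quot f g = f * fps_right_inverse g 1"

lemma fps_quot_mult_cancel: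
  assumes "fps_nth g 0 = 1"
  shows "fps_quot f g * g = f"
proof -
  have "fps_quot f g * g = f * (g * fps_right_inverse g 1)"
    by (simp only: fps_quot_def mult_ac)
  also have "g * fps_right_inverse g 1 = 1"
    using assms by (intro fps_right_inverse) simp
  finally show ?thesis by simp
qed

text \<open>
  \<open>S x1 x2 n\<close> and \<open>S_neg x1 x2 n\<close> are \<open>S\<^sub>n(X)\<close> and \<open>S\<^sub>n(-X)\<close> for \<open>X = {x1, x2}\<close>. The index of
  \<open>S\<close> is an integer so that \<open>S\<^sub>2\<^sub>n\<^sub>-\<^sub>1(X)\<close> at \<open>n = 0\<close> is \<open>S\<^sub>-\<^sub>1(X) = 0\<close>.
\<close>

definition S :: "'a::comm_ring_1 \<Rightarrow> 'a \<Rightarrow> int \<Rightarrow> 'a" where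
  "S x1 x2 n = (if n < 0 then 0 else fps_nth (fps_quot 1 (linear_prod x1 x2)) (nat n))"

definition S_neg :: "'a::comm_ring_1 \<Rightarrow> 'a \<Rightarrow> nat \<Rightarrow> 'a" where
  "S_neg x1 x2 n = fps_nth (linear_prod x1 x2) n"

lemma S_generating_function:
  "Abs_fps (\<lambda>n. S x1 x2 (int n)) * ((1 - fps_const x1 * fps_X) * (1 - fps_const x2 * fps_X)) = 1"
proof -
  have "Abs_fps (\<lambda>n. S x1 x2 (int n)) = fps_quot 1 (linear_prod x1 x2)"
    by (simp add: fps_eq_iff S_def)
  then show ?thesis
    using fps_quot_mult_cancel[of "linear_prod x1 x2" 1] by (simp add: linear_prod_def)
qed

end

theory Submission
  imports Defs
begin

text \<open>
  Put \<open>T n = S\<^sub>2\<^sub>n\<^sub>-\<^sub>1(E)\<close>, so that \<open>T (n+1) = e1\<^sup>2 T n + (e1 + e2) e2\<^sup>2\<^sup>n\<close>. Multiply the left-hand series by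
  \<open>(1 - a1 e1\<^sup>2 z) (1 - a2 e1\<^sup>2 z)\<close> and use this to write all products \<open>e1\<^sup>2\<^sup>j T (n-j)\<close> in terms of
  \<open>T n\<close>: the terms containing \<open>T n\<close> cancel by the recurrence for \<open>S\<^sub>n(A)\<close>, and what remains is the
  numerator times the series \<open>\<Sum> S\<^sub>n(A) e2\<^sup>2\<^sup>n z\<^sup>n\<close>, the inverse of \<open>(1 - a1 e2\<^sup>2 z) (1 - a2 e2\<^sup>2 z)\<close>.
  No division by \<open>e1 - e2\<close> is needed, so the identity holds over every commutative ring.
\<close>

text \<open>A constant term \<open>1\<close> makes \<open>g\<close> invertible, so a quotient is
  determined by cross-multiplication.\<close>

lemma fps_quot_eqI:
  assumes "fps_nth g 0 = 1" and "h * g = f"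
  shows "fps_quot f g = h"
proof -
  have "g * fps_right_inverse g 1 = 1"
    using assms(1) by (intro fps_right_inverse) simp
  then show ?thesis
    unfolding fps_quot_def assms(2)[symmetric] by (simp add: mult.assoc)
qed

lemma linear_prod_expand:
  "linear_prod x y = 1 - fps_const (x + y) * fps_X + fps_const (x * y) * fps_X ^ 2"
  by (simp add: linear_prod_def algebra_simps power2_eq_square
      flip: fps_const_add fps_const_mult)

lemma fps_nth_mult_quadratic:
  fixes f :: "'a::comm_ring_1 fps"
  defines "g \<equiv> \<lambda>b c. 1 - fps_const b * fps_X + fps_const c * fps_X ^ 2"
  shows "fps_nth (f * g b c) 0 = fps_nth f 0"
    and "fps_nth (f * g b c) (Suc 0) = fps_nth f (Suc 0) - b * fps_nth f 0"
    and "fps_nth (f * g b c) (Suc (Suc n)) =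
      fps_nth f (Suc (Suc n)) - b * fps_nth f (Suc n) + c * fps_nth f n"
proof -
  have *: "f * g b c = f - fps_const b * (fps_X * f) + fps_const c * (fps_X ^ 2 * f)"
    by (simp add: g_def algebra_simps)
  show "fps_nth (f * g b c) 0 = fps_nth f 0"
    and "fps_nth (f * g b c) (Suc 0) = fps_nth f (Suc 0) - b * fps_nth f 0"
    and "fps_nth (f * g b c) (Suc (Suc n)) =
      fps_nth f (Suc (Suc n)) - b * fps_nth f (Suc n) + c * fps_nth f n"
    unfolding * by (simp_all add: fps_X_power_mult_nth)
qed

lemma
  shows S_0: "S x y 0 = 1"
    and S_1: "S x y 1 = x + y"
    and S_rec: "S x y (int (Suc (Suc n))) = (x + y) * S x y (int (Suc n)) - x * y * S x y (int n)"
proof -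
  let ?H = "Abs_fps (\<lambda>n. S x y (int n))"
  have H: "?H * (1 - fps_const (x + y) * fps_X + fps_const (x * y) * fps_X ^ 2) = 1"
    using S_generating_function[of x y] linear_prod_expand[of x y] by (simp add: linear_prod_def)
  show 0: "S x y 0 = 1"
    using fps_nth_mult_quadratic(1)[of ?H "x + y" "x * y"] unfolding H by simp
  show "S x y 1 = x + y"
    using fps_nth_mult_quadratic(2)[of ?H "x + y" "x * y"] 0 unfolding H by simp
  show "S x y (int (Suc (Suc n))) = (x + y) * S x y (int (Suc n)) - x * y * S x y (int n)"
    using fps_nth_mult_quadratic(3)[of ?H "x + y" "x * y" n] unfolding H
    by (simp add: algebra_simps)
qed

text \<open>The quadratic recurrence has roots \<open>x\<close> and \<open>y\<close>, so the
  difference of \<open>S x y (n+1)\<close> and \<open>x * S x y n\<close> is geometric with ratio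
  \<open>y\<close>. This first-order form takes the place of the closed formula with denominator
  \<open>x - y\<close>.\<close>

lemma S_Suc: "S x y (int (Suc n)) = x * S x y (int n) + y ^ Suc n"
proof (induction n)
  case 0
  show ?case using S_0[of x y] S_1[of x y] by simp
next
  case (Suc n)
  have "S x y (int (Suc (Suc n))) - x * S x y (int (Suc n)) =
      y * (S x y (int (Suc n)) - x * S x y (int n))"
    unfolding S_rec by (simp only: algebra_simps)
  also have "\<dots> = y ^ Suc (Suc n)"
    unfolding Suc.IH by simp
  finally show ?case by (simp only: algebra_simps)
qed

lemma S_odd_0: "S x y (2 * int 0 - 1) = 0"
  by (simp add: S_def)

lemma S_odd_Suc:
  "S x y (2 * int (Suc n) - 1) = x ^ 2 * S x y (2 * int n - 1) + (x + y) * y ^ (2 * n)"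
\<comment> \<open>At \<open>n = 0\<close> the index is \<open>-1\<close>, where \<open>S\<close> is
  \<open>0\<close> by convention; \<open>S_Suc\<close> only covers natural indices.\<close>
proof (cases n)
  case 0
  then show ?thesis using S_1[of x y] by (simp add: S_def)
next
  case (Suc m)
  have idx: "2 * int (Suc n) - 1 = int (Suc (Suc (Suc (2 * m))))"
    "2 * int n - 1 = int (Suc (2 * m))"
    using Suc by simp_all
  show ?thesis
    unfolding idx S_Suc[of x y "Suc (Suc (2 * m))"] S_Suc[of x y "Suc (2 * m)"]
    using Suc by (simp add: algebra_simps power2_eq_square)
qed

text \<open>This is \<open>linear_prod x y\<close> under the substitution of \<open>c * z\<close>
  for \<open>z\<close>.\<close>

lemma Abs_fps_S_neg:
  "Abs_fps (\<lambda>n. S_neg x y n * c ^ n) =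
    1 - fps_const ((x + y) * c) * fps_X + fps_const (x * y * c ^ 2) * fps_X ^ 2"
proof (rule fps_ext)
  fix n :: nat
  consider "n = 0" | "n = 1" | "n = 2" | "n > 2" by linarith
  then show "fps_nth (Abs_fps (\<lambda>n. S_neg x y n * c ^ n)) n = fps_nth
      (1 - fps_const ((x + y) * c) * fps_X + fps_const (x * y * c ^ 2) * fps_X ^ 2) n"
    by cases (auto simp: S_neg_def linear_prod_expand fps_X_power_nth power2_eq_square algebra_simps)
qed

lemma Abs_fps_S_mult_S_neg:
  "Abs_fps (\<lambda>n. S x y (int n) * c ^ n) * Abs_fps (\<lambda>n. S_neg x y n * c ^ n) = 1"
proof (rule fps_ext)
  fix n :: nat
  consider "n = 0" | "n = Suc 0" | m where "n = Suc (Suc m)"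
    by (metis not0_implies_Suc)
  then show "fps_nth (Abs_fps (\<lambda>n. S x y (int n) * c ^ n) * Abs_fps (\<lambda>n. S_neg x y n * c ^ n)) n =
      fps_nth 1 n"
  proof cases
    case 1
    then show ?thesis
      unfolding Abs_fps_S_neg by (simp add: fps_nth_mult_quadratic S_0)
  next
    case 2
    then show ?thesis
      unfolding Abs_fps_S_neg using S_1[of x y] by (simp add: fps_nth_mult_quadratic S_0)
  next
    case 3
    then show ?thesis
      unfolding Abs_fps_S_neg 3 fps_nth_mult_quadratic fps_nth_Abs_fps S_rec
      by (simp add: algebra_simps power2_eq_square)
  qed
qed

lemma Abs_fps_S_odd_mult_S_neg:
  fixes x y u v :: "'a::comm_ring_1"
  shows "Abs_fps (\<lambda>n. S x y (int n) * S u v (2 * int n - 1)) * Abs_fps (\<lambda>n. S_neg x y n * (u ^ 2) ^ n) =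
    (fps_const ((x + y) * (u + v)) * fps_X
      - fps_const (x * y * (u + v) * ((u + v) ^ 2 - 2 * u * v)) * fps_X ^ 2)
    * Abs_fps (\<lambda>n. S x y (int n) * (v ^ 2) ^ n)"
    (is "?L * _ = (fps_const ?b * fps_X - fps_const ?c * fps_X ^ 2) * ?F")
proof -
  have R: "(fps_const ?b * fps_X - fps_const ?c * fps_X ^ 2) * ?F =
      fps_const ?b * (fps_X * ?F) - fps_const ?c * (fps_X ^ 2 * ?F)"
    by (simp only: algebra_simps)
  show ?thesis
    unfolding R Abs_fps_S_neg
  proof (rule fps_ext)
    fix n :: nat
    consider "n = 0" | "n = Suc 0" | m where "n = Suc (Suc m)"
      by (metis not0_implies_Suc)
    then show "fps_nth (?L * (1 - fps_const ((x + y) * u\<^sup>2) * fps_X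
          + fps_const (x * y * (u\<^sup>2)\<^sup>2) * fps_X\<^sup>2)) n =
        fps_nth (fps_const ?b * (fps_X * ?F) - fps_const ?c * (fps_X ^ 2 * ?F)) n"
    proof cases
      case 1
      then show ?thesis
        using S_odd_0[of u v] by (simp add: fps_nth_mult_quadratic)
    next
      case 2
      then show ?thesis
        using S_odd_0[of u v] S_odd_Suc[of u v 0] S_0[of x y] S_1[of x y]
        by (simp add: fps_nth_mult_quadratic fps_X_power_mult_nth)
    next
      case 3
      \<comment> \<open>With \<open>T n = S u v (2 * n - 1)\<close>, two uses of
        \<open>S_odd_Suc\<close> give
        \<open>T (m+2) = u^4 * T m + (u + v) * (u^2 + v^2) * v^(2*m)\<close>, which is the source of
        this factor.\<close>
      have sq: "(u + v) ^ 2 - 2 * u * v = u ^ 2 + v ^ 2"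
        by (simp add: power2_eq_square algebra_simps)
      show ?thesis
        unfolding 3 fps_nth_mult_quadratic fps_nth_Abs_fps S_rec S_odd_Suc sq
        by (simp add: fps_X_power_mult_nth power_mult algebra_simps power2_eq_square)
    qed
  qed
qed

lemma Abs_fps_S_mult_S_odd:
  fixes x y u v :: "'a::comm_ring_1"
  shows "Abs_fps (\<lambda>n. S x y (int n) * S u v (2 * int n - 1)) =
    fps_quot
      (fps_const ((x + y) * (u + v)) * fps_X
        - fps_const (x * y * (u + v) * ((u + v)^2 - 2 * u * v)) * fps_X^2)
      (Abs_fps (\<lambda>n. S_neg x y n * u^(2 * n)) * Abs_fps (\<lambda>n. S_neg x y n * v^(2 * n)))"
  \<comment> \<open>Writing \<open>u^(2*n)\<close> as \<open>(u^2)^n\<close> exposes the scalings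
    \<open>c = u^2\<close> and \<open>c = v^2\<close>.\<close>
  unfolding power_mult
proof (rule fps_quot_eqI[symmetric], goal_cases)
  case 1
  show ?case by (simp add: S_neg_def linear_prod_def)
next
  case 2
  show ?case
    \<comment> \<open>The \<open>u\<close> factor turns the left side into the numerator times a
      series that the \<open>v\<close> factor then cancels.\<close>
    unfolding mult.assoc[symmetric] Abs_fps_S_odd_mult_S_neg
    unfolding mult.assoc Abs_fps_S_mult_S_neg by simp
qed

theorem theorem1:
  shows "Abs_fps (\<lambda>n. S a1 a2 (int n) * S e1 e2 (2 * int n - 1)) =
    fps_quot
      (fps_const ((a1 + a2) * (e1 + e2)) * fps_X
        - fps_const (a1 * a2 * (e1 + e2) * ((e1 + e2)^2 - 2 * e1 * e2)) * fps_X^2)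
      (Abs_fps (\<lambda>n. S_neg a1 a2 n * e1^(2 * n)) * Abs_fps (\<lambda>n. S_neg a1 a2 n * e2^(2 * n)))"
  by (rule Abs_fps_S_mult_S_odd)

end
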